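(* Let $\mathcal P$ be a feasible graph parameter, and let $k\ge2$ and $n\ge2k$ be integers. For the relevant integers $s$ put $R_{n,s}=K_{s+1}\vee(sK_1\cup K_{n-2s-1})$. Then $$\mathrm{ex}_{\mathcal P}(n,\mathsf{HC};\delta\ge k)=\max_{k-1\le s\le\lfloor n/2\rfloor-1}\mathcal P(R_{n,s}),$$ and $$\mathrm{EX}_{\mathcal P}(n,\mathsf{HC};\delta\ge k)=\left\{R_{n,s}: k-1\le s\le\lfloor n/2\rfloor-1,\ \mathcal P(R_{n,s})=\mathrm{ex}_{\mathcal P}(n,\mathsf{HC};\delta\ge k)\right\}.$$
   Context: All graphs are finite and simple; graph equality is up to isomorphism. A graph parameter is a real-valued isomorphism invariant of graphs. $H_1\cup H_2$ denotes disjoint union and $H_1\vee H_2$ denotes join (disjoint union plus all edges between the two graphs); $sK_1$ is the edgeless graph on $s$ vertices. $\delta$ is the minimum degree. A graph is Hamiltonian-connected (also: Hamilton-connected) if every pair of distinct vertices is joined by a Hamilton path; $\mathsf{HC}$ denotes this property. Kelmans operation: for distinct vertices $x,y$ of a graph $G$, let $W=N_G(x)\setminus N_G[y]$, where $N_G[y]=N_G(y)\cup\{y\}$, and let $G[x\to y]=G-\{xw:w\in W\}+\{yw:w\in W\}$. A graph parameter $\mathcal P$ is feasible if for every graph $G$ (connected or not): (P1) $\mathcal P(G+F)>\mathcal P(G)$ for every nonempty set $F\subseteq\binom{V(G)}2\setminus E(G)$ such that $G+F$ is connected, where $G+F$ has vertex set $V(G)$ and edge set $E(G)\cup F$; (P2)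 $\mathcal P(G[x\to y])\ge\mathcal P(G)$ for every ordered pair of distinct vertices $x,y\in V(G)$. $\mathrm{ex}_{\mathcal P}(n,\mathsf{HC};\delta\ge k)$ is the maximum of $\mathcal P$ over all graphs of order $n$ and minimum degree at least $k$ that are not Hamiltonian-connected, and $\mathrm{EX}_{\mathcal P}(n,\mathsf{HC};\delta\ge k)$ is the family of all such graphs (up to isomorphism) attaining this maximum. *)

theory Defs
  imports Complex_Main
begin

text \<open>A graph is a pair of a vertex set and a set of two-element sets of vertices.\<close>

type_synonym 'a ugraph = "'a set \<times> 'a set set"

abbreviation verts :: "'a ugraph \<Rightarrow> 'a set" where
  "verts G \<equiv> fst G"

abbreviation edges :: "'a ugraph \<Rightarrow> 'a set set" where
  "edges G \<equiv> snd G"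

definition pairs :: "'a set \<Rightarrow> 'a set set" where
  "pairs V = {e. e \<subseteq> V \<and> card e = 2}"

definition simple_graph :: "'a ugraph \<Rightarrow> bool" where
  "simple_graph G \<longleftrightarrow> finite (verts G) \<and> edges G \<subseteq> pairs (verts G)"

definition isomorphic :: "'a ugraph \<Rightarrow> 'b ugraph \<Rightarrow> bool" where
  "isomorphic G H \<longleftrightarrow>
     (\<exists>f. bij_betw f (verts G) (verts H) \<and>
          (\<forall>u\<in>verts G. \<forall>v\<in>verts G. {u, v} \<in> edges G \<longleftrightarrow> {f u, f v} \<in> edges H))"

definition iso_class :: "'a ugraph \<Rightarrow> 'a ugraph set" where
  "iso_class G = {H. simple_graph H \<and> isomorphic G H}"

definition connected_graph :: "'a ugraph \<Rightarrow> bool" where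
  "connected_graph G \<longleftrightarrow> verts G \<noteq> {} \<and>
     (\<forall>u\<in>verts G. \<forall>v\<in>verts G. (u, v) \<in> {(a, b). {a, b} \<in> edges G}\<^sup>*)"

definition neighbors :: "'a ugraph \<Rightarrow> 'a \<Rightarrow> 'a set" where
  "neighbors G x = {w \<in> verts G. {x, w} \<in> edges G}"

definition min_degree :: "'a ugraph \<Rightarrow> nat" where
  "min_degree G = Min ((\<lambda>x. card (neighbors G x)) ` verts G)"

definition hamilton_path :: "'a ugraph \<Rightarrow> 'a \<Rightarrow> 'a \<Rightarrow> 'a list \<Rightarrow> bool" where
  "hamilton_path G u v p \<longleftrightarrow>
     p \<noteq> [] \<and> hd p = u \<and> last p = v \<and> distinct p \<and> set p = verts G \<and>
     (\<forall>i. Suc i < length p \<longrightarrow> {p ! i, p ! Suc i} \<in> edges G)"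

definition hamiltonian_connected :: "'a ugraph \<Rightarrow> bool" where
  "hamiltonian_connected G \<longleftrightarrow>
     (\<forall>u\<in>verts G. \<forall>v\<in>verts G. u \<noteq> v \<longrightarrow> (\<exists>p. hamilton_path G u v p))"

definition complete_graph :: "'a set \<Rightarrow> 'a ugraph" where
  "complete_graph V = (V, pairs V)"

definition edgeless_graph :: "'a set \<Rightarrow> 'a ugraph" where
  "edgeless_graph V = (V, {})"

text \<open>The operands of the next two operations are meant to have disjoint vertex sets.\<close>

definition graph_union :: "'a ugraph \<Rightarrow> 'a ugraph \<Rightarrow> 'a ugraph" where
  "graph_union G H = (verts G \<union> verts H, edges G \<union> edges H)"

definition graph_join :: "'a ugraph \<Rightarrow> 'a ugraph \<Rightarrow> 'a ugraph" where
  "graph_join G H =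
     (verts G \<union> verts H,
      edges G \<union> edges H \<union> {{a, b} | a b. a \<in> verts G \<and> b \<in> verts H})"

definition add_edges :: "'a ugraph \<Rightarrow> 'a set set \<Rightarrow> 'a ugraph" where
  "add_edges G F = (verts G, edges G \<union> F)"

definition kelmans :: "'a ugraph \<Rightarrow> 'a \<Rightarrow> 'a \<Rightarrow> 'a ugraph" where
  "kelmans G x y =
     (let W = neighbors G x - (neighbors G y \<union> {y})
      in (verts G, (edges G - {{x, w} | w. w \<in> W}) \<union> {{y, w} | w. w \<in> W}))"

text \<open>
  Every finite graph is isomorphic to one whose vertices are natural numbers, so an
  isomorphism invariant of finite graphs is the same thing as an isomorphism invariant of
  simple graphs of type \<^typ>\<open>nat ugraph\<close>. Values at pairs that are not simple graphs are
  irrelevant and left unconstrained.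
\<close>

definition graph_parameter :: "(nat ugraph \<Rightarrow> real) \<Rightarrow> bool" where
  "graph_parameter P \<longleftrightarrow>
     (\<forall>G H. simple_graph G \<and> simple_graph H \<and> isomorphic G H \<longrightarrow> P G = P H)"

definition feasible :: "(nat ugraph \<Rightarrow> real) \<Rightarrow> bool" where
  "feasible P \<longleftrightarrow> graph_parameter P \<and>
     (\<forall>G F. simple_graph G \<and> F \<noteq> {} \<and> F \<subseteq> pairs (verts G) - edges G \<and>
            connected_graph (add_edges G F) \<longrightarrow> P (add_edges G F) > P G) \<and>
     (\<forall>G x y. simple_graph G \<and> x \<in> verts G \<and> y \<in> verts G \<and> x \<noteq> y \<longrightarrow>
            P (kelmans G x y) \<ge> P G)"

text \<open>All labelled graphs of order \<open>n\<close> and minimum degree at least \<open>k\<close> without property \<open>Q\<close>.\<close>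

definition graphs_without ::
  "(nat ugraph \<Rightarrow> bool) \<Rightarrow> nat \<Rightarrow> nat \<Rightarrow> nat ugraph set" where
  "graphs_without Q n k =
     {G. simple_graph G \<and> card (verts G) = n \<and> min_degree G \<ge> k \<and> \<not> Q G}"

text \<open>
  The set \<^term>\<open>graphs_without Q n k\<close> is infinite, but the set of values of a graph parameter
  on it is finite (lemma \<open>finite_parameter_values\<close> below), so the maximum is a genuine one
  whenever there is such a graph.
\<close>

definition ex_number ::
  "(nat ugraph \<Rightarrow> real) \<Rightarrow> (nat ugraph \<Rightarrow> bool) \<Rightarrow> nat \<Rightarrow> nat \<Rightarrow> real" where
  "ex_number P Q n k = Max (P ` graphs_without Q n k)"

text \<open>The extremal graphs up to isomorphism, that is, the set of their isomorphism classes.\<close>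

definition EX_family ::
  "(nat ugraph \<Rightarrow> real) \<Rightarrow> (nat ugraph \<Rightarrow> bool) \<Rightarrow> nat \<Rightarrow> nat \<Rightarrow> nat ugraph set set" where
  "EX_family P Q n k =
     iso_class ` {G \<in> graphs_without Q n k. P G = ex_number P Q n k}"

text \<open>
  \<open>K\<^sub>s\<^sub>+\<^sub>1 \<or> (s K\<^sub>1 \<union> K\<^sub>n\<^sub>-\<^sub>2\<^sub>s\<^sub>-\<^sub>1)\<close>, realised on \<open>{0..<n}\<close> by consecutive blocks of
  sizes \<open>s + 1\<close>, \<open>s\<close> and \<open>n - 2 s - 1\<close>; intended for \<open>2 s + 1 \<le> n\<close>.
\<close>

definition R_graph :: "nat \<Rightarrow> nat \<Rightarrow> nat ugraph" where
  "R_graph n s =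
     graph_join (complete_graph {0..<s + 1})
       (graph_union (edgeless_graph {s + 1..<2 * s + 1}) (complete_graph {2 * s + 1..<n}))"

lemma simple_graph_R_graph: "simple_graph (R_graph n s)"
  by (auto simp: R_graph_def graph_join_def graph_union_def complete_graph_def
      edgeless_graph_def simple_graph_def pairs_def)

lemma card_verts_R_graph:
  assumes "2 * s + 1 \<le> n"
  shows "card (verts (R_graph n s)) = n"
proof -
  have "verts (R_graph n s) = {0..<n}"
    using assms by (auto simp: R_graph_def graph_join_def graph_union_def complete_graph_def
        edgeless_graph_def)
  then show ?thesis by simp
qed

lemma finite_parameter_values:
  assumes "graph_parameter P"
  shows "finite (P ` graphs_without Q n k)"
proof -
  let ?A = "Pow {..<n} \<times> Pow (Pow {..<n})"
  have "P ` graphs_without Q n k \<subseteq> P ` ?A"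
  proof
    fix r assume "r \<in> P ` graphs_without Q n k"
    then obtain G where G: "simple_graph G" "card (verts G) = n" and r: "r = P G"
      by (auto simp: graphs_without_def)
    have fin: "finite (verts G)" and E: "\<And>e. e \<in> edges G \<Longrightarrow> e \<subseteq> verts G \<and> card e = 2"
      using G(1) by (auto simp: simple_graph_def pairs_def)
    obtain f where f: "bij_betw f (verts G) {..<n}"
      using fin G(2) by (metis atLeast0LessThan ex_bij_betw_finite_nat)
    then have inj: "inj_on f (verts G)" and img: "f ` verts G = {..<n}"
      by (auto simp: bij_betw_def)
    define H where "H = ({..<n}, (`) f ` edges G)"
    have "card (f ` e) = 2" "f ` e \<subseteq> {..<n}" if "e \<in> edges G" for e
      using E[OF that] inj img by (auto simp: card_image inj_on_subset)
    then have H: "simple_graph H" "H \<in> ?A"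
      unfolding H_def simple_graph_def pairs_def by auto
    have "{u, v} \<in> edges G \<longleftrightarrow> f ` {u, v} \<in> (`) f ` edges G"
      if "u \<in> verts G" "v \<in> verts G" for u v
      using E inj that by (auto simp: inj_on_image_eq_iff simp del: image_insert)
    then have "isomorphic G H"
      using f unfolding isomorphic_def H_def by (intro exI[of _ f]) auto
    then have "P G = P H"
      using assms G(1) H(1) unfolding graph_parameter_def by blast
    then show "r \<in> P ` ?A" using r H(2) by blast
  qed
  then show ?thesis by (rule finite_subset) simp
qed

end

theory Submission
  imports Defs
begin

text \<open>
  By Berge's theorem (proved with the Bondy--Chvatal closure), a graph that is not
  Hamiltonian-connected has, for some \<open>s\<close> in the range, a set \<open>S\<close> of \<open>s\<close> vertices of degree at most
  \<open>s + 1\<close> inside a set \<open>B\<close> of \<open>n - s - 1\<close> vertices of degree at most \<open>n - s - 1\<close>. Let \<open>T\<close> be the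
  complement of \<open>B\<close>. Kelmans operations from vertices outside \<open>T\<close> to vertices of \<open>T\<close> do not
  increase degrees in \<open>S\<close>, and once they have no further effect the graph is a subgraph of the
  copy of \<open>R\<^sub>n\<^sub>,\<^sub>s\<close> with parts \<open>T\<close>, \<open>S\<close>: an edge from \<open>S\<close> to a vertex outside \<open>T\<close> would force that
  vertex of \<open>S\<close> to be adjacent to all of \<open>T\<close> as well. A proper subgraph has a smaller parameter.
  Otherwise, since Kelmans operations preserve the degree sum, every degree bound was already
  tight in the original graph, which makes it equal to that copy.
\<close>

section \<open>Edges and neighbourhoods of simple graphs\<close>

abbreviation deg :: "'a ugraph \<Rightarrow> 'a \<Rightarrow> nat" where
  "deg G x \<equiv> card (neighbors G x)"

lemma simple_edgeD:
  assumes "simple_graph G" "{a, b} \<in> edges G"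
  shows "a \<noteq> b" "a \<in> verts G" "b \<in> verts G"
  using assms by (auto simp: simple_graph_def pairs_def)

lemma edge_of_simple_graph:
  assumes "simple_graph G" "e \<in> edges G"
  obtains a b where "e = {a, b}" "a \<noteq> b" "a \<in> verts G" "b \<in> verts G"
  using assms by (auto simp: simple_graph_def pairs_def card_2_iff subset_iff)

lemma mem_neighbors:
  assumes "simple_graph G"
  shows "w \<in> neighbors G x \<longleftrightarrow> {x, w} \<in> edges G"
  using simple_edgeD[OF assms] by (auto simp: neighbors_def)

lemma finite_neighbors: "simple_graph G \<Longrightarrow> finite (neighbors G x)"
  by (auto simp: neighbors_def simple_graph_def)

lemma neighbors_subset: "simple_graph G \<Longrightarrow> neighbors G x \<subseteq> verts G - {x}"
  by (auto simp: neighbors_def dest: simple_edgeD)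

lemma edges_subset_iff_neighbors_subset:
  assumes "simple_graph G" "simple_graph H"
  shows "edges G \<subseteq> edges H \<longleftrightarrow> (\<forall>x\<in>verts G. neighbors G x \<subseteq> neighbors H x)"
proof
  assume "edges G \<subseteq> edges H"
  then show "\<forall>x\<in>verts G. neighbors G x \<subseteq> neighbors H x"
    by (auto simp: mem_neighbors[OF assms(1)] mem_neighbors[OF assms(2)])
next
  assume *: "\<forall>x\<in>verts G. neighbors G x \<subseteq> neighbors H x"
  show "edges G \<subseteq> edges H"
  proof
    fix e assume e: "e \<in> edges G"
    then obtain a b where ab: "e = {a, b}" "a \<in> verts G"
      by (rule edge_of_simple_graph[OF assms(1)])
    then have "b \<in> neighbors G a" using e by (simp add: mem_neighbors[OF assms(1)])
    then have "b \<in> neighbors H a" using * ab(2) by blast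
    then show "e \<in> edges H" using ab(1) by (simp add: mem_neighbors[OF assms(2)])
  qed
qed

lemma simple_graph_eqI:
  assumes "simple_graph G" "simple_graph H" "verts G = verts H"
    and "\<And>x. x \<in> verts G \<Longrightarrow> neighbors G x = neighbors H x"
  shows "G = H"
proof (rule prod_eqI[OF assms(3)])
  show "edges G = edges H"
    using edges_subset_iff_neighbors_subset[OF assms(1,2)]
      edges_subset_iff_neighbors_subset[OF assms(2,1)] assms(3,4)
    by (intro equalityI) auto
qed

section \<open>Isomorphism\<close>

lemma isomorphic_sym:
  assumes "isomorphic G H"
  shows "isomorphic H G"
proof -
  obtain f where f: "bij_betw f (verts G) (verts H)"
    and e: "\<And>u v. u \<in> verts G \<Longrightarrow> v \<in> verts G \<Longrightarrow> {u, v} \<in> edges G \<longleftrightarrow> {f u, f v} \<in> edges H"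
    using assms unfolding isomorphic_def by blast
  define g where "g = inv_into (verts G) f"
  have g: "bij_betw g (verts H) (verts G)"
    unfolding g_def by (rule bij_betw_inv_into[OF f])
  have "{u, v} \<in> edges H \<longleftrightarrow> {g u, g v} \<in> edges G" if "u \<in> verts H" "v \<in> verts H" for u v
    using e[of "g u" "g v"] that bij_betw_apply[OF g] bij_betw_inv_into_right[OF f]
    by (simp add: g_def)
  then show ?thesis using g unfolding isomorphic_def by blast
qed

lemma isomorphic_trans:
  assumes "isomorphic G H" "isomorphic H K"
  shows "isomorphic G K"
proof -
  obtain f where f: "bij_betw f (verts G) (verts H)"
    and ef: "\<And>u v. u \<in> verts G \<Longrightarrow> v \<in> verts G \<Longrightarrow> {u, v} \<in> edges G \<longleftrightarrow> {f u, f v} \<in> edges H"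
    using assms(1) unfolding isomorphic_def by blast
  obtain g where g: "bij_betw g (verts H) (verts K)"
    and eg: "\<And>u v. u \<in> verts H \<Longrightarrow> v \<in> verts H \<Longrightarrow> {u, v} \<in> edges H \<longleftrightarrow> {g u, g v} \<in> edges K"
    using assms(2) unfolding isomorphic_def by blast
  have "{u, v} \<in> edges G \<longleftrightarrow> {(g \<circ> f) u, (g \<circ> f) v} \<in> edges K"
    if "u \<in> verts G" "v \<in> verts G" for u v
    using ef eg that bij_betw_apply[OF f] by simp
  then show ?thesis
    using bij_betw_trans[OF f g] unfolding isomorphic_def by blast
qed

lemma iso_class_eqI:
  assumes "isomorphic G H"
  shows "iso_class G = iso_class H"
  using isomorphic_trans isomorphic_sym assms unfolding iso_class_def by blast

section \<open>Degree conditions for Hamilton paths\<close>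

lemma hamilton_path_iff_successively:
  "hamilton_path G u v p \<longleftrightarrow>
     p \<noteq> [] \<and> hd p = u \<and> last p = v \<and> distinct p \<and> set p = verts G \<and>
     successively (\<lambda>a b. {a, b} \<in> edges G) p"
  by (auto simp: hamilton_path_def successively_conv_nth)

lemma successively_edge_rev:
  "successively (\<lambda>a b. {a, b} \<in> E) (rev xs) \<longleftrightarrow> successively (\<lambda>a b. {a, b} \<in> E) xs"
  by (simp add: successively_rev insert_commute)

text \<open>Only the \<open>i\<close>-th step of the path may be missing in \<open>G\<close>; reversing the segment between the
  \<open>i\<close>-th and the \<open>j\<close>-th step replaces both steps by the edges of the last two assumptions.\<close>

lemma hamilton_path_rotate:
  assumes p: "hamilton_path (verts G, E') u v p"
    and i: "Suc i < length p" and j: "Suc j < length p" "j \<noteq> i"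
    and E: "\<And>l. Suc l < length p \<Longrightarrow> l \<noteq> i \<Longrightarrow> {p ! l, p ! Suc l} \<in> edges G"
    and xj: "{p ! i, p ! j} \<in> edges G" and yj: "{p ! Suc i, p ! Suc j} \<in> edges G"
  shows "\<exists>q. hamilton_path G u v q"
proof -
  let ?R = "\<lambda>a b. {a, b} \<in> edges G"
  \<comment> \<open>The two new edges are symmetric in \<open>i\<close> and \<open>j\<close>, so it
    does not matter which of the two steps comes first on the path.\<close>
  define a b where "a = min i j" and "b = max i j"
  have ab: "a < b" "Suc b < length p" using i j by (auto simp: a_def b_def)
  define xs ys zs where "xs = take (Suc a) p" and "ys = drop (Suc a) (take (Suc b) p)"
    and "zs = drop (Suc b) p"
  have p_eq: "p = xs @ ys @ zs"
    using ab append_take_drop_id[of "Suc a" "take (Suc b) p"] append_take_drop_id[of "Suc b" p]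
    unfolding xs_def ys_def zs_def by (simp flip: append_assoc)
  have ends_p: "hd p = u" "last p = v" "distinct p" "set p = verts G"
    using p by (simp_all add: hamilton_path_def)
  have ne: "xs \<noteq> []" "ys \<noteq> []" "zs \<noteq> []" using ab by (auto simp: xs_def ys_def zs_def)
  have "last xs = p ! a"
    using ab by (simp add: xs_def take_Suc_conv_app_nth)
  moreover have "last ys = p ! b" "hd ys = p ! Suc a" "hd zs = p ! Suc b"
    using ab by (simp_all add: ys_def zs_def last_conv_nth hd_drop_conv_nth)
  ultimately have ends: "last xs = p ! a" "last ys = p ! b" "hd ys = p ! Suc a" "hd zs = p ! Suc b"
    by blast+
  have part: "successively ?R xs" "successively ?R ys" "successively ?R zs"
    using ab by (auto simp: successively_conv_nth xs_def ys_def zs_def a_def b_def intro!: E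
        split: if_splits)
  have link: "{p ! a, p ! b} \<in> edges G" "{p ! Suc a, p ! Suc b} \<in> edges G"
    using xj yj by (auto simp: a_def b_def min_def max_def insert_commute)
  \<comment> \<open>The ends stay \<open>u\<close> and \<open>v\<close>, since \<open>xs\<close> and
    \<open>zs\<close> are nonempty and keep their direction.\<close>
  let ?q = "xs @ rev ys @ zs"
  have "successively ?R ?q"
    using part link ne
    by (simp add: successively_append_iff successively_edge_rev ends hd_rev last_rev
        del: successively_rev)
  moreover have "?q \<noteq> []" "hd ?q = u" "last ?q = v" "distinct ?q" "set ?q = verts G"
    using ends_p ne by (auto simp: p_eq)
  ultimately have "hamilton_path G u v ?q" by (simp only: hamilton_path_iff_successively simp_thms)
  then show ?thesis by blast
qed

text \<open>Ore's crossing argument: a step \<open>j\<close> whose first vertex is a neighbour of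
  \<open>x\<close> and whose second is a neighbour of \<open>y\<close> permits the rotation, and
  pigeonhole provides one. The degree bound is one larger than for Hamilton cycles because the ends
  of the path are fixed.\<close>

lemma hamilton_path_closure_oriented:
  assumes G: "simple_graph G"
    and p: "hamilton_path (add_edges G {{x, y}}) u v p"
    and i: "Suc i < length p" "p ! i = x" "p ! Suc i = y"
    and deg: "deg G x + deg G y \<ge> card (verts G) + 1"
  shows "\<exists>q. hamilton_path G u v q"
proof -
  define n where "n = card (verts G)"
  have dp: "distinct p" "set p = verts G" and
    step: "\<And>l. Suc l < length p \<Longrightarrow> {p ! l, p ! Suc l} \<in> insert {x, y} (edges G)"
    using p unfolding hamilton_path_def add_edges_def by auto
  have len: "length p = n" using dp by (metis distinct_card n_def)
  have other: "{p ! l, p ! Suc l} \<in> edges G" if l: "Suc l < length p" "l \<noteq> i" for l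
  proof (rule ccontr)
    assume "{p ! l, p ! Suc l} \<notin> edges G"
    then have "{p ! l, p ! Suc l} = {p ! i, p ! Suc i}" using step[OF l(1)] i by auto
    then have "p ! l = p ! Suc i \<and> p ! Suc l = p ! i"
      using l i dp by (auto simp: doubleton_eq_iff nth_eq_iff_index_eq)
    then show False using l i dp by (auto simp: nth_eq_iff_index_eq)
  qed
  define A where "A = {l. Suc l < n \<and> p ! l \<in> neighbors G x}"
  define B where "B = {l. Suc l < n \<and> p ! Suc l \<in> neighbors G y}"
  \<comment> \<open>Step \<open>i\<close> runs from \<open>x\<close> to \<open>y\<close>, and
    neither is its own neighbour. So \<open>A\<close> and \<open>B\<close> share
    \<open>n - 2\<close> positions, while the degree bound will give them at least
    \<open>n - 1\<close> elements together.\<close>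
  have sub: "A \<subseteq> {..<n - 1} - {i}" "B \<subseteq> {..<n - 1} - {i}"
    using i neighbors_subset[OF G] by (auto simp: A_def B_def)
  have fin: "finite A" "finite B"
    using sub finite_subset[of _ "{..<n - 1} - {i}"] by auto
  \<comment> \<open>The last vertex of the path starts no step, so one neighbour of \<open>x\<close>
    may go uncounted; for \<open>y\<close> the same happens with the first vertex.\<close>
  have "neighbors G x \<subseteq> insert (p ! (n - 1)) ((!) p ` A)"
  proof
    fix w assume w: "w \<in> neighbors G x"
    then have "w \<in> set p" using dp neighbors_subset[OF G] by auto
    then obtain l where "l < n" "w = p ! l" using len by (auto simp: in_set_conv_nth)
    then show "w \<in> insert (p ! (n - 1)) ((!) p ` A)"
      using w by (cases "l = n - 1") (auto simp: A_def)
  qed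
  then have "deg G x \<le> card (insert (p ! (n - 1)) ((!) p ` A))"
    using fin by (intro card_mono) auto
  also have "\<dots> \<le> Suc (card A)"
    using card_image_le[OF fin(1), of "(!) p"] fin by (auto simp: card_insert_if)
  finally have cA: "deg G x \<le> Suc (card A)" .
  have "neighbors G y \<subseteq> insert (p ! 0) ((\<lambda>l. p ! Suc l) ` B)"
  proof
    fix w assume w: "w \<in> neighbors G y"
    then have "w \<in> set p" using dp neighbors_subset[OF G] by auto
    then obtain l where "l < n" "w = p ! l" using len by (auto simp: in_set_conv_nth)
    then show "w \<in> insert (p ! 0) ((\<lambda>l. p ! Suc l) ` B)"
      using w by (cases l) (auto simp: B_def)
  qed
  then have "deg G y \<le> card (insert (p ! 0) ((\<lambda>l. p ! Suc l) ` B))"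
    using fin by (intro card_mono) auto
  also have "\<dots> \<le> Suc (card B)"
    using card_image_le[OF fin(2), of "\<lambda>l. p ! Suc l"] fin
    by (auto simp: card_insert_if)
  finally have cB: "deg G y \<le> Suc (card B)" .
  have "A \<inter> B \<noteq> {}"
  proof
    assume "A \<inter> B = {}"
    then have "card A + card B = card (A \<union> B)" using fin by (simp add: card_Un_disjoint)
    also have "\<dots> \<le> card ({..<n - 1} - {i})" using sub by (intro card_mono) auto
    also have "\<dots> = n - 2" using i len by simp
    finally show False using cA cB deg i len unfolding n_def[symmetric] by linarith
  qed
  then obtain j where "j \<in> A" "j \<in> B" by blast
  then have "Suc j < length p" "j \<noteq> i" "{p ! i, p ! j} \<in> edges G" "{p ! Suc i, p ! Suc j} \<in> edges G"
    using sub len i by (auto simp: A_def B_def mem_neighbors[OF G])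
  then show ?thesis
    using hamilton_path_rotate[of G "edges G \<union> {{x, y}}" u v p i j] p i other
    by (auto simp: add_edges_def)
qed

text \<open>Edges are unordered, so the path may cross the new edge in either direction; if it
  avoids that edge, it already lies in \<open>G\<close>.\<close>

lemma hamilton_path_closure:
  assumes G: "simple_graph G"
    and p: "hamilton_path (add_edges G {{x, y}}) u v p"
    and deg: "deg G x + deg G y \<ge> card (verts G) + 1"
  shows "\<exists>q. hamilton_path G u v q"
proof (cases "\<exists>i. Suc i < length p \<and> {p ! i, p ! Suc i} = {x, y}")
  case True
  then obtain i where i: "Suc i < length p" "{p ! i, p ! Suc i} = {x, y}" by blast
  then consider "p ! i = x" "p ! Suc i = y" | "p ! i = y" "p ! Suc i = x"
    by (auto simp: doubleton_eq_iff)
  then show ?thesis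
  proof cases
    case 1
    then show ?thesis using hamilton_path_closure_oriented[OF G p i(1)] deg by blast
  next
    case 2
    then show ?thesis
      using hamilton_path_closure_oriented[of G y x u v p i] G p i(1) deg
      by (simp add: insert_commute add.commute)
  qed
next
  case False
  then have "hamilton_path G u v p"
    using p unfolding hamilton_path_def add_edges_def by auto
  then show ?thesis by blast
qed

lemma hamilton_path_complete_graph:
  assumes "finite V" "u \<in> V" "v \<in> V" "u \<noteq> v"
  shows "\<exists>p. hamilton_path (complete_graph V) u v p"
proof -
  obtain xs where xs: "set xs = V - {u, v}" "distinct xs"
    using finite_distinct_list[of "V - {u, v}"] assms(1) by auto
  let ?p = "u # xs @ [v]"
  have d: "distinct ?p" and s: "set ?p = V" using xs assms by auto
  have "{?p ! i, ?p ! Suc i} \<in> pairs V" if i: "Suc i < length ?p" for i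
  proof -
    have "?p ! i \<noteq> ?p ! Suc i"
      using d i nth_eq_iff_index_eq[OF d, of i "Suc i"] by simp
    moreover have "?p ! i \<in> V" "?p ! Suc i \<in> V"
      using i s nth_mem[of i ?p] nth_mem[of "Suc i" ?p] by simp_all
    ultimately show ?thesis by (auto simp: pairs_def)
  qed
  then have "hamilton_path (complete_graph V) u v ?p"
    using d s unfolding hamilton_path_def complete_graph_def by auto
  then show ?thesis by blast
qed

text \<open>An edge-maximal supergraph does the work of the closure: joining a nonadjacent pair with
  degree sum above the order would create a Hamilton path, and the closure lemma would turn it into
  one of \<open>H\<close> itself.\<close>

lemma maximal_without_hamilton_path:
  assumes G: "simple_graph G" and no: "\<nexists>p. hamilton_path G u v p"
  obtains H where "simple_graph H" "verts H = verts G" "edges G \<subseteq> edges H"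
    "\<nexists>p. hamilton_path H u v p"
    "\<And>x y. x \<in> verts G \<Longrightarrow> y \<in> verts G \<Longrightarrow> x \<noteq> y \<Longrightarrow> {x, y} \<notin> edges H \<Longrightarrow>
       deg H x + deg H y \<le> card (verts G)"
proof -
  let ?V = "verts G"
  define \<E> where "\<E> = {E. edges G \<subseteq> E \<and> E \<subseteq> pairs ?V \<and> (\<nexists>p. hamilton_path (?V, E) u v p)}"
  have "finite ?V" using G by (simp add: simple_graph_def)
  then have "finite (Pow (Pow ?V))" by simp
  moreover have "\<E> \<subseteq> Pow (Pow ?V)" by (auto simp: \<E>_def pairs_def)
  ultimately have "finite \<E>" by (rule rev_finite_subset)
  moreover have "edges G \<in> \<E>" using G no by (simp add: \<E>_def simple_graph_def)
  ultimately obtain E where E: "E \<in> \<E>" and max: "\<And>F. F \<in> \<E> \<Longrightarrow> E \<subseteq> F \<Longrightarrow> E = F"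
    using finite_has_maximal[of \<E>] by blast
  let ?H = "(?V, E)"
  have H: "simple_graph ?H" using E \<open>finite ?V\<close> by (simp add: \<E>_def simple_graph_def)
  have "deg ?H x + deg ?H y \<le> card ?V"
    if xy: "x \<in> ?V" "y \<in> ?V" "x \<noteq> y" "{x, y} \<notin> E" for x y
  proof (rule ccontr)
    assume *: "\<not> ?thesis"
    have "insert {x, y} E \<notin> \<E>" using max[of "insert {x, y} E"] xy(4) by blast
    then obtain p where "hamilton_path (?V, insert {x, y} E) u v p"
      using E xy unfolding \<E>_def by (auto simp: pairs_def)
    then have "\<exists>q. hamilton_path ?H u v q"
      using hamilton_path_closure[OF H, of x y u v p] * xy by (simp add: add_edges_def)
    then show False using E by (simp add: \<E>_def)
  qed
  then show ?thesis using that[of ?H] H E by (simp add: \<E>_def)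
qed

text \<open>Berge's analogue of Chvatal's theorem on degree sequences.\<close>

lemma not_hamiltonian_connected_degrees:
  assumes G: "simple_graph G" and n: "card (verts G) = n"
    and k: "\<And>x. x \<in> verts G \<Longrightarrow> k \<le> deg G x" "k \<ge> 1"
    and no: "\<not> hamiltonian_connected G"
  obtains s S B where "k - 1 \<le> s" "s \<le> n div 2 - 1" "S \<subseteq> B" "B \<subseteq> verts G"
    "card S = s" "card B = n - s - 1"
    "\<And>x. x \<in> S \<Longrightarrow> deg G x \<le> s + 1" "\<And>x. x \<in> B \<Longrightarrow> deg G x \<le> n - s - 1"
proof -
  let ?V = "verts G"
  have fin: "finite ?V" using G by (simp add: simple_graph_def)
  obtain u v where uv: "u \<in> ?V" "v \<in> ?V" "u \<noteq> v" "\<nexists>p. hamilton_path G u v p"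
    using no unfolding hamiltonian_connected_def by blast
  obtain H where H: "simple_graph H" "verts H = ?V" "edges G \<subseteq> edges H"
    "\<nexists>p. hamilton_path H u v p" and
    sum: "\<And>x y. x \<in> ?V \<Longrightarrow> y \<in> ?V \<Longrightarrow> x \<noteq> y \<Longrightarrow> {x, y} \<notin> edges H \<Longrightarrow> deg H x + deg H y \<le> n"
    using maximal_without_hamilton_path[OF G uv(4)] n by metis
  have GH: "deg G x \<le> deg H x" if "x \<in> ?V" for x
    using edges_subset_iff_neighbors_subset[OF G H(1)] H(3) that
    by (intro card_mono finite_neighbors H) blast
  define Q where "Q = (\<lambda>(x, y). x \<in> ?V \<and> y \<in> ?V \<and> x \<noteq> y \<and> {x, y} \<notin> edges H)"
  \<comment> \<open>Otherwise \<open>H\<close> would be complete and have a Hamilton path from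
    \<open>u\<close> to \<open>v\<close>.\<close>
  have "\<exists>z. Q z"
  proof (rule ccontr)
    assume none: "\<nexists>z. Q z"
    have "pairs ?V \<subseteq> edges H"
    proof
      fix e assume "e \<in> pairs ?V"
      then obtain a b where "e = {a, b}" "a \<noteq> b" "a \<in> ?V" "b \<in> ?V"
        by (auto simp: pairs_def card_2_iff)
      then show "e \<in> edges H" using none by (auto simp: Q_def)
    qed
    then have "H = complete_graph ?V"
      using H by (auto simp: complete_graph_def simple_graph_def intro!: prod_eqI)
    then show False using hamilton_path_complete_graph[OF fin uv(1-3)] H(4) by blast
  qed
  then obtain z0 where "Q z0" ..
  moreover have "\<forall>z. Q z \<longrightarrow> (case z of (x, y) \<Rightarrow> deg H x + deg H y) < Suc n"
    using sum by (auto simp: Q_def less_Suc_eq_le)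
  \<comment> \<open>A nonadjacent pair of largest degree sum is taken; its maximality will bound the
    degrees of all non-neighbours of either vertex.\<close>
  ultimately obtain z where "Q z" and z: "\<forall>z'. Q z' \<longrightarrow>
      (case z' of (x, y) \<Rightarrow> deg H x + deg H y) \<le> (case z of (x, y) \<Rightarrow> deg H x + deg H y)"
    using ex_has_greatest_nat[of Q z0 "\<lambda>(x, y). deg H x + deg H y" "Suc n"] by blast
  obtain x0 y0 where "z = (x0, y0)" by (cases z)
  then have Q0: "Q (x0, y0)" and
    max0: "\<And>a b. Q (a, b) \<Longrightarrow> deg H a + deg H b \<le> deg H x0 + deg H y0"
    using \<open>Q z\<close> z by auto
  have "\<exists>x y. Q (x, y) \<and> deg H x + deg H y = deg H x0 + deg H y0 \<and> deg H x \<le> deg H y"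
  proof (cases "deg H x0 \<le> deg H y0")
    case False
    then show ?thesis using Q0 by (intro exI[of _ y0] exI[of _ x0]) (auto simp: Q_def insert_commute)
  qed (use Q0 in blast)
  then obtain x y where Qxy: "Q (x, y)" and le: "deg H x \<le> deg H y"
    and max: "\<And>a b. Q (a, b) \<Longrightarrow> deg H a + deg H b \<le> deg H x + deg H y"
    using max0 by metis
  have xy: "x \<in> ?V" "y \<in> ?V" "x \<noteq> y" "{x, y} \<notin> edges H" using Qxy by (auto simp: Q_def)
  \<comment> \<open>The degree of \<open>x\<close> is at least \<open>k\<close>, hence positive, so
    the subtraction is not truncated.\<close>
  define s where "s = deg H x - 1"
  have "k \<le> deg H x" using k(1)[OF xy(1)] GH[OF xy(1)] by simp
  then have dx: "deg H x = s + 1" and ks: "k - 1 \<le> s" using k(2) by (auto simp: s_def)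
  have dy: "s + 1 \<le> deg H y" "deg H y \<le> n - s - 1" "2 * s + 2 \<le> n"
    using le dx sum[OF xy] by auto
  \<comment> \<open>Replacing \<open>x\<close> by another non-neighbour of \<open>y\<close> cannot
    raise the degree sum, so degrees in \<open>S'\<close> are at most that of \<open>x\<close>.
    Likewise degrees in \<open>B'\<close>, which contains \<open>x\<close> itself, are at most that
    of \<open>y\<close>.\<close>
  define S' where "S' = ?V - {y} - neighbors H y"
  define B' where "B' = ?V - neighbors H x"
  have "card S' = n - 1 - deg H y"
    unfolding S'_def using neighbors_subset[OF H(1), of y] H(2) xy n fin
    by (subst card_Diff_subset) (auto intro: finite_subset)
  then have cS': "s \<le> card S'" using dy by simp
  have "card B' = n - deg H x"
    unfolding B'_def using neighbors_subset[OF H(1), of x] H(2) n fin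
    by (subst card_Diff_subset) (auto intro: finite_subset)
  then have cB': "card B' = n - s - 1" using dx by simp
  have degS': "deg H a \<le> s + 1" if "a \<in> S'" for a
  proof -
    have "Q (a, y)"
      using that xy by (auto simp: S'_def Q_def mem_neighbors[OF H(1)] insert_commute)
    then show ?thesis using max[of a y] dx by simp
  qed
  have degB': "deg H b \<le> n - s - 1" if "b \<in> B'" for b
  proof (cases "b = x")
    case True
    then show ?thesis using dx dy by simp
  next
    case False
    then have "Q (x, b)"
      using that xy by (auto simp: B'_def Q_def mem_neighbors[OF H(1)])
    then show ?thesis using max[of x b] dy by simp
  qed
  obtain S where S: "S \<subseteq> S'" "card S = s"
    using obtain_subset_with_card_n[OF cS'] by metis
  have fin': "finite S'" "finite B'" using fin by (auto simp: S'_def B'_def)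
  have "card (S' \<union> B') \<ge> n - s - 1"
    using cB' card_mono[of "S' \<union> B'" B'] fin' by simp
  \<comment> \<open>\<open>S\<close> need not lie in \<open>B'\<close>, so \<open>B\<close> is
    chosen between \<open>S\<close> and \<open>S' \<union> B'\<close>. This is safe because
    \<open>s + 1\<close> is at most \<open>n - s - 1\<close>.\<close>
  then obtain B where B: "S \<subseteq> B" "B \<subseteq> S' \<union> B'" "card B = n - s - 1"
    using exists_subset_between[of S "n - s - 1" "S' \<union> B'"] S fin' dy by auto
  have sub: "S' \<subseteq> ?V" "B' \<subseteq> ?V" by (auto simp: S'_def B'_def)
  show ?thesis
  proof (rule that[of s S B])
    show "s \<le> n div 2 - 1" using dy by linarith
    show "B \<subseteq> ?V" using B sub by blast
    show "deg G a \<le> s + 1" if "a \<in> S" for a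
      using degS'[of a] GH[of a] that S sub by force
    show "deg G b \<le> n - s - 1" if b: "b \<in> B" for b
    proof -
      have "deg H b \<le> n - s - 1"
        using b B degS'[of b] degB'[of b] dy by force
      then show ?thesis using GH[of b] b B sub by force
    qed
  qed (use ks B S in auto)
qed


section \<open>The extremal graphs\<close>

text \<open>With \<open>|T| = s + 1\<close>, \<open>|S| = s\<close> and \<open>T\<close>, \<open>S\<close> disjoint this is \<open>R\<^sub>n\<^sub>,\<^sub>s\<close>: the set \<open>T\<close> is
  the clique joined to everything and \<open>S\<close> is the independent set.\<close>

definition block_graph :: "'a set \<Rightarrow> 'a set \<Rightarrow> 'a set \<Rightarrow> 'a ugraph" where
  "block_graph V T S = (V, {e \<in> pairs V. e \<inter> S = {} \<or> e \<inter> T \<noteq> {}})"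

lemma verts_block_graph [simp]: "verts (block_graph V T S) = V"
  by (simp add: block_graph_def)

lemma edge_block_graph:
  "{a, b} \<in> edges (block_graph V T S) \<longleftrightarrow>
     a \<noteq> b \<and> a \<in> V \<and> b \<in> V \<and> (a \<notin> S \<and> b \<notin> S \<or> a \<in> T \<or> b \<in> T)"
  by (auto simp: block_graph_def pairs_def card_2_iff)

lemma simple_block_graph: "finite V \<Longrightarrow> simple_graph (block_graph V T S)"
  by (auto simp: simple_graph_def block_graph_def)

lemma neighbors_block_graph:
  assumes "finite V" "T \<subseteq> V" "S \<subseteq> V" "T \<inter> S = {}" "x \<in> V"
  shows "neighbors (block_graph V T S) x =
    (if x \<in> T then V - {x} else if x \<in> S then T else V - S - {x})"
  using assms edge_block_graph[of x x V T S, simplified]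
  by (auto simp: mem_neighbors[OF simple_block_graph] edge_block_graph split: if_splits)

lemma deg_block_graph:
  assumes "finite V" "T \<subseteq> V" "S \<subseteq> V" "T \<inter> S = {}" "x \<in> V"
    and "card V = n" "card S = s" "card T = s + 1"
  shows "deg (block_graph V T S) x =
    (if x \<in> T then n - 1 else if x \<in> S then s + 1 else n - s - 1)"
proof -
  have "card (V - S - {x}) = n - s - 1" if "x \<notin> S"
    using assms that by (simp add: card_Diff_subset finite_subset)
  then show ?thesis using assms by (simp add: neighbors_block_graph)
qed

text \<open>Any vertex of \<open>T\<close> is adjacent to all others. Connectedness is what (P1)
  asks of the enlarged graph.\<close>

lemma connected_block_graph:
  assumes "T \<subseteq> V" "T \<noteq> {}"
  shows "connected_graph (block_graph V T S)"
proof -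
  obtain t where t: "t \<in> T" "t \<in> V" using assms by blast
  let ?r = "{(a, b). {a, b} \<in> edges (block_graph V T S)}"
  have "(u, t) \<in> ?r\<^sup>*" "(t, u) \<in> ?r\<^sup>*" if "u \<in> V" for u
    using that t by (cases "u = t"; auto simp: edge_block_graph intro!: r_into_rtrancl)+
  then show ?thesis unfolding connected_graph_def using t
    by (metis (no_types, lifting) empty_iff rtrancl_trans verts_block_graph)
qed

text \<open>Adjacency of distinct vertices depends only on which of \<open>T\<close>,
  \<open>S\<close> and the remainder contain them, so bijections between corresponding parts can be
  glued.\<close>

lemma isomorphic_block_graph:
  assumes V: "finite V" "T \<subseteq> V" "S \<subseteq> V" "T \<inter> S = {}"
    and V': "finite V'" "T' \<subseteq> V'" "S' \<subseteq> V'" "T' \<inter> S' = {}"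
    and card: "card V = card V'" "card T = card T'" "card S = card S'"
  shows "isomorphic (block_graph V T S) (block_graph V' T' S')"
proof -
  have fin: "finite T" "finite S" "finite T'" "finite S'"
    using V V' finite_subset by blast+
  obtain f1 where f1: "bij_betw f1 T T'" using fin card finite_same_card_bij by blast
  obtain f2 where f2: "bij_betw f2 S S'" using fin card finite_same_card_bij by blast
  have "card (V - (T \<union> S)) = card (V' - (T' \<union> S'))"
    using V V' card fin by (simp add: card_Diff_subset card_Un_disjoint)
  then obtain f3 where f3: "bij_betw f3 (V - (T \<union> S)) (V' - (T' \<union> S'))"
    using V V' finite_same_card_bij by (metis finite_Diff)
  define f where "f = (\<lambda>v. if v \<in> T then f1 v else if v \<in> S then f2 v else f3 v)"
  have b1: "bij_betw f T T'" using f1 by (rule bij_betw_cong[THEN iffD1, rotated]) (simp add: f_def)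
  have b2: "bij_betw f S S'"
    using f2 by (rule bij_betw_cong[THEN iffD1, rotated]) (use V in \<open>auto simp: f_def\<close>)
  have b3: "bij_betw f (V - (T \<union> S)) (V' - (T' \<union> S'))"
    using f3 by (rule bij_betw_cong[THEN iffD1, rotated]) (auto simp: f_def)
  have "bij_betw f (T \<union> S \<union> (V - (T \<union> S))) (T' \<union> S' \<union> (V' - (T' \<union> S')))"
    by (intro bij_betw_combine b1 b2 b3) (use V' in auto)
  moreover have "T \<union> S \<union> (V - (T \<union> S)) = V" "T' \<union> S' \<union> (V' - (T' \<union> S')) = V'"
    using V V' by auto
  ultimately have b: "bij_betw f V V'" by simp
  have inj: "inj_on f V" using b by (rule bij_betw_imp_inj_on)
  have memT: "f v \<in> T' \<longleftrightarrow> v \<in> T" if "v \<in> V" for v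
    using that b1 inj V(2) by (metis bij_betw_imp_surj_on inj_on_image_mem_iff)
  have memS: "f v \<in> S' \<longleftrightarrow> v \<in> S" if "v \<in> V" for v
    using that b2 inj V(3) by (metis bij_betw_imp_surj_on inj_on_image_mem_iff)
  have "{u, v} \<in> edges (block_graph V T S) \<longleftrightarrow> {f u, f v} \<in> edges (block_graph V' T' S')"
    if "u \<in> V" "v \<in> V" for u v
    using that memT memS inj bij_betw_apply[OF b] by (auto simp: edge_block_graph inj_on_eq_iff)
  then show ?thesis using b unfolding isomorphic_def by (intro exI[of _ f]) simp
qed

text \<open>Passing from joins to a description by two vertex sets allows comparison with copies on
  other vertex sets.\<close>

lemma R_graph_eq_block_graph:
  assumes "2 * s + 1 \<le> n"
  shows "R_graph n s = block_graph {0..<n} {0..<s + 1} {s + 1..<2 * s + 1}"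
proof (rule simple_graph_eqI)
  show v: "verts (R_graph n s) = verts (block_graph {0..<n} {0..<s + 1} {s + 1..<2 * s + 1})"
    using assms by (auto simp: R_graph_def graph_join_def graph_union_def complete_graph_def
        edgeless_graph_def)
  have join: "(\<exists>c d. {a, b} = {c, d} \<and> Q c d) \<longleftrightarrow> Q a b \<or> Q b a"
    for a b :: nat and Q
    by (auto simp: doubleton_eq_iff)
  have pair: "{a, b} \<in> pairs A \<longleftrightarrow> a \<noteq> b \<and> a \<in> A \<and> b \<in> A" for a b :: nat and A
    by (auto simp: pairs_def card_2_iff)
  have V: "{0..<n} = {0..<s + 1} \<union> {s + 1..<2 * s + 1} \<union> {2 * s + 1..<n}" using assms by auto
  have disj: "{0..<s + 1} \<inter> {s + 1..<2 * s + 1} = {}" "{0..<s + 1} \<inter> {2 * s + 1..<n} = {}"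
    "{s + 1..<2 * s + 1} \<inter> {2 * s + 1..<n} = {}"
    by auto
  have "{a, b} \<in> edges (R_graph n s) \<longleftrightarrow>
      {a, b} \<in> edges (block_graph {0..<n} {0..<s + 1} {s + 1..<2 * s + 1})" for a b
    unfolding edge_block_graph V R_graph_def graph_join_def graph_union_def complete_graph_def
      edgeless_graph_def fst_conv snd_conv Un_iff empty_iff mem_Collect_eq join pair
    using disj by blast
  then show "neighbors (R_graph n s) x =
      neighbors (block_graph {0..<n} {0..<s + 1} {s + 1..<2 * s + 1}) x" for x
    using v by (simp add: neighbors_def)
qed (simp_all add: simple_graph_R_graph simple_block_graph)

text \<open>The vertices of \<open>S\<close> and the last vertex of the path outside \<open>T \<union> S\<close> are followed by
  distinct vertices of \<open>T\<close> other than the start of the path: there are too many of them.\<close>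

lemma block_graph_no_hamilton_path:
  assumes V: "finite V" "T \<subseteq> V" "S \<subseteq> V" "T \<inter> S = {}"
    and card: "card T \<le> card S + 1" and rest: "V - (T \<union> S) \<noteq> {}"
    and uv: "u \<in> T" "v \<in> T"
  shows "\<not> hamilton_path (block_graph V T S) u v p"
proof
  assume "hamilton_path (block_graph V T S) u v p"
  then have p: "p \<noteq> []" "hd p = u" "last p = v" "distinct p" "set p = V"
    and step: "\<And>i. Suc i < length p \<Longrightarrow> {p ! i, p ! Suc i} \<in> edges (block_graph V T S)"
    by (auto simp: hamilton_path_def)
  let ?n = "length p"
  have p0: "p ! 0 \<in> T" and pl: "p ! (?n - 1) \<in> T"
    using p uv by (auto simp: hd_conv_nth last_conv_nth)
  define I where "I = {i. i < ?n \<and> p ! i \<in> S}"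
  define J where "J = {i. i < ?n \<and> p ! i \<in> V - (T \<union> S)}"
  have finJ: "finite J" "finite I" by (auto simp: I_def J_def)
  obtain r where "r \<in> V - (T \<union> S)" using rest by blast
  then have "J \<noteq> {}" using p(5) by (force simp: J_def in_set_conv_nth)
  \<comment> \<open>The last position outside \<open>T \<union> S\<close> supplies the one index
    needed in addition to those of \<open>S\<close>.\<close>
  define m where "m = Max J"
  have m: "m \<in> J" "\<And>j. j \<in> J \<Longrightarrow> j \<le> m"
    using finJ \<open>J \<noteq> {}\<close> by (auto simp: m_def)
  have "inj_on ((!) p) I" using p(4) by (auto simp: I_def inj_on_def nth_eq_iff_index_eq)
  moreover have "(!) p ` I = S"
  proof
    show "S \<subseteq> (!) p ` I"
    proof
      fix w assume w: "w \<in> S"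
      then have "w \<in> set p" using p(5) V(3) by blast
      then obtain i where "i < ?n" "p ! i = w" unfolding in_set_conv_nth by blast
      then show "w \<in> (!) p ` I" using w by (auto simp: I_def)
    qed
  qed (auto simp: I_def)
  ultimately have "card I = card S" using card_image[of "(!) p" I] by simp
  moreover have "m \<notin> I" using m(1) by (auto simp: I_def J_def)
  ultimately have cI: "card (insert m I) = card S + 1" using finJ by simp
  have succ: "Suc i < ?n \<and> p ! Suc i \<in> T" if "i \<in> insert m I" for i
  proof -
    have i: "i < ?n" "p ! i \<notin> T" using that m(1) V(4) by (auto simp: I_def J_def)
    then have "i \<noteq> ?n - 1" using pl by auto
    then have lt: "Suc i < ?n" using i by simp
    have e: "p ! Suc i \<in> T \<or> p ! i \<notin> S \<and> p ! Suc i \<notin> S" "p ! Suc i \<in> V"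
      using step[OF lt] i by (auto simp: edge_block_graph)
    \<comment> \<open>A vertex of \<open>S\<close> has neighbours only in \<open>T\<close>, so only
      \<open>i = m\<close> could fail, and then \<open>Suc m\<close> would be a later element of
      \<open>J\<close>.\<close>
    have "p ! Suc i \<in> T"
    proof (rule ccontr)
      assume no: "p ! Suc i \<notin> T"
      then have "i \<notin> I" "Suc i \<in> J" using e lt by (auto simp: I_def J_def)
      then show False using that m(2)[of "Suc i"] by auto
    qed
    then show ?thesis using lt by simp
  qed
  \<comment> \<open>The first vertex of the path lies in \<open>T\<close> but succeeds nothing, so
    at most \<open>card T - 1\<close> successors are available for \<open>card S + 1\<close>
    positions.\<close>
  have "(\<lambda>i. p ! Suc i) ` insert m I \<subseteq> T - {p ! 0}"
  proof (intro image_subsetI)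
    fix i assume "i \<in> insert m I"
    then have "Suc i < ?n" "p ! Suc i \<in> T" using succ by blast+
    then show "p ! Suc i \<in> T - {p ! 0}"
      using p(4) nth_eq_iff_index_eq[OF p(4), of "Suc i" 0] p(1) by auto
  qed
  moreover have "inj_on (\<lambda>i. p ! Suc i) (insert m I)"
  proof (rule inj_onI)
    fix i j assume "i \<in> insert m I" "j \<in> insert m I" "p ! Suc i = p ! Suc j"
    then show "i = j" using succ nth_eq_iff_index_eq[OF p(4), of "Suc i" "Suc j"] by blast
  qed
  moreover have finT: "finite T" using V finite_subset by blast
  ultimately have "card (insert m I) \<le> card (T - {p ! 0})"
    by (metis card_image card_mono finite_Diff)
  also have "\<dots> = card T - 1" using p0 finT by simp
  finally show False using cI card by linarith
qed

text \<open>All degrees are at least \<open>s + 1\<close>, hence at least \<open>k\<close>. The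
  bound \<open>1 \<le> s\<close> puts both \<open>0\<close> and \<open>1\<close> into the dominating
  clique, and \<open>2 * s + 2 \<le> n\<close> keeps the last block nonempty.\<close>

lemma R_graph_in_graphs_without:
  assumes "1 \<le> k" "k - 1 \<le> s" "1 \<le> s" "2 * s + 2 \<le> n"
  shows "R_graph n s \<in> graphs_without hamiltonian_connected n k"
proof -
  let ?T = "{0..<s + 1}" and ?S = "{s + 1..<2 * s + 1}"
  let ?G = "block_graph {0..<n} ?T ?S"
  have R: "R_graph n s = ?G" using assms by (intro R_graph_eq_block_graph) simp
  have "k \<le> deg ?G x" if "x \<in> {0..<n}" for x
    using deg_block_graph[of "{0..<n}" ?T ?S x n s] that assms by auto
  then have "k \<le> min_degree ?G"
    using assms unfolding min_degree_def by (subst Min_ge_iff) auto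
  moreover have "\<not> hamiltonian_connected ?G"
  proof
    assume "hamiltonian_connected ?G"
    moreover have "(0::nat) \<noteq> 1" "0 \<in> verts ?G" "1 \<in> verts ?G" using assms by auto
    ultimately obtain p where "hamilton_path ?G 0 1 p"
      unfolding hamiltonian_connected_def by blast
    moreover have "2 * s + 1 \<in> {0..<n} - (?T \<union> ?S)" using assms by auto
    then have "{0..<n} - (?T \<union> ?S) \<noteq> {}" by blast
    then have "\<not> hamilton_path ?G 0 1 p"
      by (intro block_graph_no_hamilton_path) (use assms in auto)
    ultimately show False by blast
  qed
  ultimately show ?thesis
    unfolding graphs_without_def R using simple_block_graph by auto
qed

section \<open>Kelmans operations\<close>

context
  fixes G :: "'a ugraph" and x y :: 'a and W :: "'a set"
  assumes G: "simple_graph G" and xy: "x \<in> verts G" "y \<in> verts G" "x \<noteq> y"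
  defines "W \<equiv> neighbors G x - (neighbors G y \<union> {y})"
begin

lemma edges_kelmans:
  "edges (kelmans G x y) = (edges G - {{x, w} | w. w \<in> W}) \<union> {{y, w} | w. w \<in> W}"
  by (simp add: kelmans_def W_def Let_def)

lemma verts_kelmans: "verts (kelmans G x y) = verts G"
  by (simp add: kelmans_def Let_def)

lemma simple_kelmans: "simple_graph (kelmans G x y)"
proof -
  have "{y, w} \<in> pairs (verts G)" if "w \<in> W" for w
    using that xy by (auto simp: W_def pairs_def neighbors_def card_2_iff)
  then show ?thesis
    using G unfolding simple_graph_def edges_kelmans verts_kelmans by auto
qed

lemma neighbors_kelmans:
  "neighbors (kelmans G x y) z =
    (if z = x then neighbors G x - W
     else if z = y then neighbors G y \<union> W
     else if z \<in> W then insert y (neighbors G z - {x})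
     else neighbors G z)"
proof -
  have W: "x \<notin> W" "y \<notin> W" using neighbors_subset[OF G] by (auto simp: W_def)
  show ?thesis
    using W xy(3)
    by (auto simp: mem_neighbors[OF simple_kelmans] mem_neighbors[OF G] edges_kelmans
        doubleton_eq_iff)
qed

text \<open>\<open>x\<close> hands the vertices of \<open>W\<close> over to \<open>y\<close>, and
  each of them trades its neighbour \<open>x\<close> for \<open>y\<close>. The first equation is
  additive to avoid subtraction of naturals.\<close>

lemma deg_kelmans:
  "deg (kelmans G x y) x + card W = deg G x"
  "deg (kelmans G x y) y = deg G y + card W"
  "z \<noteq> x \<Longrightarrow> z \<noteq> y \<Longrightarrow> deg (kelmans G x y) z = deg G z"
proof -
  have W: "W \<subseteq> neighbors G x" "W \<inter> neighbors G y = {}" by (auto simp: W_def)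
  have fin: "finite W" using W(1) finite_neighbors[OF G] finite_subset by blast
  have "card W \<le> deg G x" using W(1) finite_neighbors[OF G] by (rule card_mono[rotated])
  then show "deg (kelmans G x y) x + card W = deg G x"
    using W(1) fin by (simp add: neighbors_kelmans card_Diff_subset)
  show "deg (kelmans G x y) y = deg G y + card W"
    using xy(3) W(2) fin finite_neighbors[OF G]
    by (simp add: neighbors_kelmans card_Un_disjoint Int_commute)
  show "deg (kelmans G x y) z = deg G z" if z: "z \<noteq> x" "z \<noteq> y"
  proof (cases "z \<in> W")
    case True
    then have "x \<in> neighbors G z" "y \<notin> neighbors G z"
      by (auto simp: W_def mem_neighbors[OF G] insert_commute)
    then have "card (insert y (neighbors G z - {x})) = deg G z"
      using finite_neighbors[OF G] card.remove[of "neighbors G z" x] by simp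
    then show ?thesis using True z by (simp add: neighbors_kelmans)
  qed (use z in \<open>simp add: neighbors_kelmans\<close>)
qed

text \<open>Of the two vertices whose degrees may change, only \<open>x\<close> is counted in
  \<open>A\<close>. With \<open>A\<close> the complement of \<open>T\<close>, the sum drops strictly
  whenever \<open>W\<close> is nonempty.\<close>

lemma sum_deg_kelmans:
  assumes "finite A" "x \<in> A" "y \<notin> A"
  shows "(\<Sum>v\<in>A. deg (kelmans G x y) v) + card W = (\<Sum>v\<in>A. deg G v)"
proof -
  have "(\<Sum>v\<in>A - {x}. deg (kelmans G x y) v) = (\<Sum>v\<in>A - {x}. deg G v)"
    using assms by (intro sum.cong) (auto intro: deg_kelmans(3))
  then show ?thesis
    using assms deg_kelmans(1) by (simp add: sum.remove[of A x])
qed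

lemma sum_deg_kelmans_total:
  "(\<Sum>v\<in>verts G. deg (kelmans G x y) v) = (\<Sum>v\<in>verts G. deg G v)"
proof -
  have "finite (verts G)" using G by (simp add: simple_graph_def)
  \<comment> \<open>Away from \<open>y\<close> the sum loses \<open>card W\<close>, exactly what
    \<open>y\<close> gains.\<close>
  then show ?thesis
    using sum_deg_kelmans[of "verts G - {y}"] deg_kelmans(2) xy
    by (simp add: sum.remove[of "verts G" y])
qed

end

section \<open>Shifting edges towards a fixed vertex set\<close>

text \<open>A vertex of \<open>S\<close> with a neighbour \<open>w\<close> outside \<open>T\<close>
  would, by \<open>shift\<close>, be adjacent to all of \<open>T\<close> and so have
  \<open>s + 2\<close> neighbours. As \<open>w\<close> may itself lie in \<open>S\<close>, this also
  rules out edges inside \<open>S\<close>.\<close>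

lemma shifted_edges_subset_block_graph:
  assumes G: "simple_graph G" and T: "T \<subseteq> verts G" "card T = s + 1" and S: "T \<inter> S = {}"
    and deg: "\<And>x. x \<in> S \<Longrightarrow> deg G x \<le> s + 1"
    and shift: "\<And>x y. x \<in> verts G - T \<Longrightarrow> y \<in> T \<Longrightarrow> neighbors G x \<subseteq> insert y (neighbors G y)"
  shows "edges G \<subseteq> edges (block_graph (verts G) T S)"
proof
  have key: False if x: "x \<in> S" and w: "w \<notin> T" "{x, w} \<in> edges G" for x w
  proof -
    have wV: "w \<in> verts G - T" using w simple_edgeD[OF G] by blast
    have "y \<in> neighbors G x" if "y \<in> T" for y
    proof -
      have "x \<in> neighbors G w" using w(2) by (simp add: mem_neighbors[OF G] insert_commute)
      then have "x \<in> neighbors G y" using shift[OF wV that] x that S by blast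
      then show ?thesis by (simp add: mem_neighbors[OF G] insert_commute)
    qed
    then have "insert w T \<subseteq> neighbors G x" using w(2) by (auto simp: mem_neighbors[OF G])
    then have "card (insert w T) \<le> deg G x" by (intro card_mono finite_neighbors[OF G])
    moreover have "card (insert w T) = s + 2"
      using T w(1) G by (simp add: simple_graph_def finite_subset)
    ultimately show False using deg[OF x] by simp
  qed
  fix e assume e: "e \<in> edges G"
  then obtain a b where ab: "e = {a, b}" "a \<noteq> b" "a \<in> verts G" "b \<in> verts G"
    by (rule edge_of_simple_graph[OF G])
  then show "e \<in> edges (block_graph (verts G) T S)"
    using key[of a b] key[of b a] e by (auto simp: edge_block_graph insert_commute)
qed

text \<open>Only operations from a vertex outside \<open>T\<close> to a vertex of \<open>T\<close> are used, so that no degree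
  outside \<open>T\<close> ever increases; their sum is the termination measure.\<close>

lemma kelmans_to_block_graph:
  fixes P :: "'a ugraph \<Rightarrow> real"
  assumes P: "\<And>G x y. simple_graph G \<Longrightarrow> x \<in> verts G \<Longrightarrow> y \<in> verts G \<Longrightarrow> x \<noteq> y \<Longrightarrow>
      P G \<le> P (kelmans G x y)"
    and G: "simple_graph G" and T: "T \<subseteq> verts G" "card T = s + 1" and S: "T \<inter> S = {}"
    and deg: "\<And>x. x \<in> S \<Longrightarrow> deg G x \<le> s + 1"
  shows "\<exists>H. simple_graph H \<and> verts H = verts G \<and> P G \<le> P H \<and>
    (\<Sum>v\<in>verts G. deg H v) = (\<Sum>v\<in>verts G. deg G v) \<and>
    edges H \<subseteq> edges (block_graph (verts G) T S)"
  using G T deg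
proof (induction "\<Sum>v\<in>verts G - T. deg G v" arbitrary: G rule: less_induct)
  case less
  have fin: "finite (verts G - T)" using less.prems(1) by (simp add: simple_graph_def)
  show ?case
  proof (cases "\<forall>x\<in>verts G - T. \<forall>y\<in>T. neighbors G x \<subseteq> insert y (neighbors G y)")
    case True
    then have "edges G \<subseteq> edges (block_graph (verts G) T S)"
      using shifted_edges_subset_block_graph[OF less.prems(1-3) S less.prems(4)] by blast
    then show ?thesis using less.prems(1) by (intro exI[of _ G]) simp
  next
    case False
    then obtain x y where xy: "x \<in> verts G" "x \<notin> T" "y \<in> T" and
      W: "neighbors G x - (neighbors G y \<union> {y}) \<noteq> {}" by blast
    then have y: "y \<in> verts G" "x \<noteq> y" using less.prems(2) by auto
    let ?K = "kelmans G x y"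
    note xyG = less.prems(1) xy(1) y
    note K = simple_kelmans[OF xyG] verts_kelmans[OF xyG] P[OF xyG] sum_deg_kelmans_total[OF xyG]
    \<comment> \<open>The pair violates the shift condition, so the operation moves at least one
      edge and the measure drops.\<close>
    have "0 < card (neighbors G x - (neighbors G y \<union> {y}))"
      using W finite_neighbors[OF less.prems(1), of x] by (simp add: card_gt_0_iff)
    then have "(\<Sum>v\<in>verts ?K - T. deg ?K v) < (\<Sum>v\<in>verts G - T. deg G v)"
      using sum_deg_kelmans[OF xyG, of "verts G - T"] fin xy K(2) by simp
    \<comment> \<open>Only the degree of \<open>y\<close> can grow, and \<open>y\<close> lies in
      \<open>T\<close>, so the degree bound on \<open>S\<close> survives.\<close>
    moreover have "deg ?K v \<le> s + 1" if "v \<in> S" for v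
    proof -
      have "v \<noteq> y" using that S xy(3) by blast
      then have "deg ?K v \<le> deg G v"
        using deg_kelmans(1)[OF xyG] deg_kelmans(3)[OF xyG, of v] by (cases "v = x") auto
      then show ?thesis using less.prems(4)[OF that] by simp
    qed
    ultimately obtain H where "simple_graph H" "verts H = verts ?K" "P ?K \<le> P H"
      "(\<Sum>v\<in>verts ?K. deg H v) = (\<Sum>v\<in>verts ?K. deg ?K v)"
      "edges H \<subseteq> edges (block_graph (verts ?K) T S)"
      using less.hyps[of ?K] K(1,2) less.prems(2,3) by metis
    then show ?thesis using K by (intro exI[of _ H]) auto
  qed
qed

section \<open>Comparison with the extremal graph\<close>

text \<open>Each degree is at most the corresponding one in the block graph, so the inequality of
  sums forces equality throughout. Vertices of \<open>T\<close> are then adjacent to all others,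
  which uses up the \<open>s + 1\<close> neighbours of each vertex of \<open>S\<close>; the
  remaining vertices miss \<open>S\<close>, and their degrees leave no choice.\<close>

lemma eq_block_graph_of_deg_le:
  assumes G: "simple_graph G" "verts G = V"
    and V: "T \<subseteq> V" "S \<subseteq> V" "T \<inter> S = {}" "card V = n" "card S = s" "card T = s + 1"
    and S: "\<And>x. x \<in> S \<Longrightarrow> deg G x \<le> s + 1"
    and B: "\<And>x. x \<in> V - T \<Longrightarrow> deg G x \<le> n - s - 1"
    and sum: "(\<Sum>v\<in>V. deg (block_graph V T S) v) \<le> (\<Sum>v\<in>V. deg G v)"
  shows "G = block_graph V T S"
proof -
  let ?R = "block_graph V T S"
  have fin: "finite V" using G by (simp add: simple_graph_def)
  note dR = deg_block_graph[OF fin V(1-3) _ V(4-6)] and nR = neighbors_block_graph[OF fin V(1-3)]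
  have sub: "neighbors G x \<subseteq> V - {x}" for x using neighbors_subset[OF G(1)] G(2) by simp
  have le: "deg G x \<le> deg ?R x" if x: "x \<in> V" for x
  proof -
    have "deg G x \<le> card (V - {x})" using fin sub by (intro card_mono) auto
    then have "deg G x \<le> n - 1" using x V(4) by simp
    then show ?thesis using x S B dR by auto
  qed
  have eq: "deg G x = deg ?R x" if x: "x \<in> V" for x
  proof (rule ccontr)
    assume "deg G x \<noteq> deg ?R x"
    then have "(\<Sum>v\<in>V. deg G v) < (\<Sum>v\<in>V. deg ?R v)"
      using le x fin by (intro sum_strict_mono_ex1) (auto simp: order_less_le)
    then show False using sum by simp
  qed
  have nT: "neighbors G t = V - {t}" if t: "t \<in> T" for t
  proof (rule card_subset_eq)
    show "deg G t = card (V - {t})" using eq[of t] nR[of t] t V(1) by auto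
  qed (use fin sub in auto)
  have T_sub: "T - {x} \<subseteq> neighbors G x" if x: "x \<in> V" for x
  proof
    fix t assume t: "t \<in> T - {x}"
    then have "x \<in> neighbors G t" using nT[of t] x by auto
    then show "t \<in> neighbors G x" by (simp add: mem_neighbors[OF G(1)] insert_commute)
  qed
  have nS: "neighbors G x = T" if x: "x \<in> S" for x
  proof (rule sym, rule card_subset_eq)
    show "T \<subseteq> neighbors G x" using T_sub[of x] x V by blast
    have "x \<in> V" "x \<notin> T" using x V by auto
    then show "card T = deg G x" using eq[of x] nR[of x] x by simp
  qed (simp add: finite_neighbors G)
  have nB: "neighbors G x = V - S - {x}" if x: "x \<in> V" "x \<notin> T" "x \<notin> S" for x
  proof (rule card_subset_eq)
    have "z \<notin> S" if z: "z \<in> neighbors G x" for z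
    proof
      assume "z \<in> S"
      moreover have "x \<in> neighbors G z" using z by (simp add: mem_neighbors[OF G(1)] insert_commute)
      ultimately show False using nS x by blast
    qed
    then show "neighbors G x \<subseteq> V - S - {x}" using sub by blast
    show "deg G x = card (V - S - {x})" using eq[of x] nR[of x] x by auto
  qed (use fin in auto)
  show ?thesis
  proof (rule simple_graph_eqI)
    show "neighbors G x = neighbors ?R x" if "x \<in> verts G" for x
      using that G(2) nR[of x] nT nS nB by auto
  qed (use G fin simple_block_graph in auto)
qed

text \<open>Kelmans operations lead to a subgraph \<open>H\<close> of the block graph without
  lowering \<open>P\<close>. If it is proper, (P1) gives strict inequality; otherwise the preserved
  degree sum identifies \<open>G\<close> itself.\<close>

lemma feasible_block_graph_max:
  assumes P: "feasible P" and G: "simple_graph G" "verts G = V"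
    and V: "T \<subseteq> V" "S \<subseteq> V" "T \<inter> S = {}" "card V = n" "card S = s" "card T = s + 1"
    and S: "\<And>x. x \<in> S \<Longrightarrow> deg G x \<le> s + 1"
    and B: "\<And>x. x \<in> V - T \<Longrightarrow> deg G x \<le> n - s - 1"
  shows "P G < P (block_graph V T S) \<or> G = block_graph V T S"
proof -
  let ?R = "block_graph V T S"
  have fin: "finite V" using G by (simp add: simple_graph_def)
  have P2: "P G \<le> P (kelmans G x y)"
    if "simple_graph G" "x \<in> verts G" "y \<in> verts G" "x \<noteq> y" for G x y
    using P that unfolding feasible_def by blast
  obtain H where H: "simple_graph H" "verts H = V" "P G \<le> P H"
    "(\<Sum>v\<in>V. deg H v) = (\<Sum>v\<in>V. deg G v)" "edges H \<subseteq> edges ?R"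
    using kelmans_to_block_graph[of P G T s S] P2 G V S by blast
  show ?thesis
  proof (cases "edges H = edges ?R")
    case True
    then have "H = ?R" using H(2) by (simp add: prod_eq_iff)
    then show ?thesis using eq_block_graph_of_deg_le[OF G V S B] H(4) by simp
  next
    case False
    let ?F = "edges ?R - edges H"
    have R: "add_edges H ?F = ?R"
      using H(2,5) by (auto simp: add_edges_def prod_eq_iff)
    moreover have "?F \<noteq> {}" using False H(5) by blast
    moreover have "?F \<subseteq> pairs (verts H) - edges H"
      using H(2) by (auto simp: block_graph_def)
    moreover have "connected_graph ?R" using V by (intro connected_block_graph) auto
    ultimately have "P H < P ?R"
      using P H(1) unfolding feasible_def by metis
    then show ?thesis using H(3) by simp
  qed
qed

section \<open>The extremal number and the extremal family\<close>

lemma graph_parameter_eq: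
  "graph_parameter P \<Longrightarrow> simple_graph G \<Longrightarrow> simple_graph H \<Longrightarrow> isomorphic G H \<Longrightarrow> P G = P H"
  unfolding graph_parameter_def by blast

text \<open>Combines the degree obstruction with the comparison on the vertex set of
  \<open>G\<close>. The strict-or-isomorphic alternative determines the extremal family, the weak
  inequality the maximum.\<close>

lemma not_hamiltonian_connected_le_R_graph:
  assumes P: "feasible P" and k: "k \<ge> 2" and n: "n \<ge> 2 * k"
    and G: "G \<in> graphs_without hamiltonian_connected n k"
  obtains s where "k - 1 \<le> s" "s \<le> n div 2 - 1"
    "P G < P (R_graph n s) \<or> isomorphic G (R_graph n s)" "P G \<le> P (R_graph n s)"
proof -
  let ?V = "verts G"
  have g: "simple_graph G" "card ?V = n" "k \<le> min_degree G" "\<not> hamiltonian_connected G"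
    using G by (auto simp: graphs_without_def)
  have fin: "finite ?V" using g by (simp add: simple_graph_def)
  have degk: "k \<le> deg G x" if "x \<in> ?V" for x
    using g(3) fin that unfolding min_degree_def by (meson Min_le finite_imageI image_eqI le_trans)
  have k1: "1 \<le> k" using k by simp
  obtain s S B where s: "k - 1 \<le> s" "s \<le> n div 2 - 1" and S: "S \<subseteq> B" "B \<subseteq> ?V"
    "card S = s" "card B = n - s - 1"
    and deg: "\<And>x. x \<in> S \<Longrightarrow> deg G x \<le> s + 1" "\<And>x. x \<in> B \<Longrightarrow> deg G x \<le> n - s - 1"
    by (rule not_hamiltonian_connected_degrees[OF g(1,2) degk k1 g(4)], assumption) (rule that)
  \<comment> \<open>Since \<open>n\<close> is at least 4, \<open>n div 2 - 1\<close> is not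
    truncated.\<close>
  have sn: "2 * s + 2 \<le> n" using s k n by linarith
  define T where "T = ?V - B"
  have "card T = n - (n - s - 1)"
    unfolding T_def using S fin g(2) by (simp add: card_Diff_subset finite_subset)
  then have T: "T \<subseteq> ?V" "T \<inter> S = {}" "card T = s + 1" "?V - T = B" "S \<subseteq> ?V"
    using S sn by (auto simp: T_def)
  let ?R = "block_graph ?V T S"
  have iso: "isomorphic ?R (R_graph n s)"
    using sn by (subst R_graph_eq_block_graph, simp, intro isomorphic_block_graph)
      (use fin T S g(2) in auto)
  have "P ?R = P (R_graph n s)"
    using P simple_block_graph[OF fin] simple_graph_R_graph iso
    by (intro graph_parameter_eq) (simp_all add: feasible_def)
  moreover have "P G < P ?R \<or> G = ?R"
    by (rule feasible_block_graph_max[OF P g(1) refl T(1,5,2) g(2) S(3) T(3)])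
      (use deg T(4) in auto)
  ultimately show ?thesis using that[OF s] iso by (metis order_less_imp_le order_refl)
qed

theorem theorem1p5:
  fixes P :: "nat ugraph \<Rightarrow> real" and k n :: nat
  assumes "feasible P" and "k \<ge> 2" and "n \<ge> 2 * k"
  shows "ex_number P hamiltonian_connected n k
           = (MAX s\<in>{k - 1..n div 2 - 1}. P (R_graph n s))
       \<and> EX_family P hamiltonian_connected n k
           = {iso_class (R_graph n s) | s. k - 1 \<le> s \<and> s \<le> n div 2 - 1 \<and>
                P (R_graph n s) = ex_number P hamiltonian_connected n k}"
proof
  let ?\<G> = "graphs_without hamiltonian_connected n k" and ?I = "{k - 1..n div 2 - 1}"
  let ?ex = "ex_number P hamiltonian_connected n k"
  \<comment> \<open>Here \<open>k \<ge> 2\<close> gives \<open>1 \<le> s\<close>.\<close>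
  have R: "R_graph n s \<in> ?\<G>" if "s \<in> ?I" for s
    using that assms(2,3) by (intro R_graph_in_graphs_without) auto
  have fin: "finite (P ` ?\<G>)"
    using assms(1) by (intro finite_parameter_values) (simp add: feasible_def)
  have ne: "k - 1 \<in> ?I" using assms(3) by auto
  have le: "P G \<le> ?ex" if "G \<in> ?\<G>" for G
    using that fin unfolding ex_number_def by simp
  show "?ex = (MAX s\<in>?I. P (R_graph n s))"
  proof (rule antisym)
    have "P G \<le> (MAX s\<in>?I. P (R_graph n s))" if G: "G \<in> ?\<G>" for G
    proof -
      obtain s where "s \<in> ?I" "P G \<le> P (R_graph n s)"
        using not_hamiltonian_connected_le_R_graph[OF assms G] by (metis atLeastAtMost_iff)
      then show ?thesis by (intro order_trans[OF _ Max_ge]) auto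
    qed
    then show "?ex \<le> (MAX s\<in>?I. P (R_graph n s))"
      unfolding ex_number_def using fin R[OF ne] by (subst Max_le_iff) auto
    show "(MAX s\<in>?I. P (R_graph n s)) \<le> ?ex"
      using ne le R by (subst Max_le_iff) auto
  qed
  show "EX_family P hamiltonian_connected n k = {iso_class (R_graph n s) | s.
      k - 1 \<le> s \<and> s \<le> n div 2 - 1 \<and> P (R_graph n s) = ?ex}" (is "_ = ?rhs")
  proof
    show "EX_family P hamiltonian_connected n k \<subseteq> ?rhs"
    proof
      fix c assume "c \<in> EX_family P hamiltonian_connected n k"
      then obtain G where G: "G \<in> ?\<G>" "P G = ?ex" "c = iso_class G"
        unfolding EX_family_def by auto
      obtain s where s: "k - 1 \<le> s" "s \<le> n div 2 - 1"
        "P G < P (R_graph n s) \<or> isomorphic G (R_graph n s)" "P G \<le> P (R_graph n s)"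
        using not_hamiltonian_connected_le_R_graph[OF assms G(1)] by metis
      have "P (R_graph n s) \<le> ?ex" using s by (intro le R) simp
      \<comment> \<open>Maximality of \<open>P G\<close> excludes the strict alternative, which
        leaves the isomorphism.\<close>
      then have "P (R_graph n s) = ?ex" "c = iso_class (R_graph n s)"
        using s G iso_class_eqI[of G "R_graph n s"] by auto
      then show "c \<in> ?rhs" using s by blast
    qed
    show "?rhs \<subseteq> EX_family P hamiltonian_connected n k"
      using R unfolding EX_family_def by auto
  qed
qed

end
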